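(* Let $G$ be a bipartite graph with parts $X$ and $Y$, and let $k=\operatorname{rank}_{\mathbb{F}_2}(M)$, where $M\in\mathbb{F}_2^{X\times Y}$ is the bipartite adjacency matrix of $G$. Then $f_o(G)\ge k$.
   Context: All graphs are finite and simple (no loops, no multiple edges); isolated vertices are allowed here. The bipartite adjacency matrix $M$ has rows indexed by $X$, columns indexed by $Y$, and $(x,y)$ entry $1$ if $xy\in E(G)$ and $0$ otherwise; its rank is taken over $\mathbb{F}_2$. $f_o(G)$ denotes the maximum size of a set $S\subseteq V(G)$ such that every vertex of the induced subgraph $G[S]$ has odd degree in $G[S]$ (the empty set is vacuously allowed). *)

theory Defs
  imports "Jordan_Normal_Form.DL_Rank" "HOL-Library.Z2"
begin

definition simple_graph :: "'a set \<Rightarrow> 'a set set \<Rightarrow> bool" where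
  "simple_graph V E \<longleftrightarrow> finite V \<and> (\<forall>e\<in>E. e \<subseteq> V \<and> card e = 2)"

definition bipartite_with_parts :: "'a set \<Rightarrow> 'a set set \<Rightarrow> 'a set \<Rightarrow> 'a set \<Rightarrow> bool" where
  "bipartite_with_parts V E X Y \<longleftrightarrow>
     X \<union> Y = V \<and> X \<inter> Y = {} \<and> (\<forall>e\<in>E. \<exists>x\<in>X. \<exists>y\<in>Y. e = {x, y})"

definition induced_edges :: "'a set set \<Rightarrow> 'a set \<Rightarrow> 'a set set" where
  "induced_edges E S = {e \<in> E. e \<subseteq> S}"

definition vdegree :: "'a set set \<Rightarrow> 'a \<Rightarrow> nat" where
  "vdegree E v = card {e \<in> E. v \<in> e}"

text \<open>For finite \<open>V\<close> the maximum is over a finite set, nonempty because of \<open>S = {}\<close>.\<close>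

definition f_o :: "'a set \<Rightarrow> 'a set set \<Rightarrow> nat" where
  "f_o V E = Max {card S | S. S \<subseteq> V \<and> (\<forall>v\<in>S. odd (vdegree (induced_edges E S) v))}"

text \<open>Library matrices are indexed by initial segments of the natural numbers, so the parts are
  given by duplicate-free enumerations \<open>xs\<close> (rows) and \<open>ys\<close> (columns). The type \<open>bit\<close> is the
  field with two elements.\<close>

definition bip_adj_mat :: "'a set set \<Rightarrow> 'a list \<Rightarrow> 'a list \<Rightarrow> bit mat" where
  "bip_adj_mat E xs ys =
     mat (length xs) (length ys) (\<lambda>(i, j). if {xs ! i, ys ! j} \<in> E then 1 else 0)"

text \<open>\<open>vec_space.rank n A\<close> is the column rank of \<open>A\<close>, where \<open>n\<close> is the number of rows.\<close>

definition bip_rank :: "'a set set \<Rightarrow> 'a list \<Rightarrow> 'a list \<Rightarrow> nat" where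
  "bip_rank E xs ys = vec_space.rank (length xs) (bip_adj_mat E xs ys)"

end

theory Submission
  imports Defs
begin

text \<open>
  Let \<open>J\<close> be a set of \<open>k\<close> linearly independent columns. Some set of rows sums to the all-ones
  vector on \<open>J\<close>; a smallest such set \<open>A\<close> is linearly independent on \<open>J\<close>. By duality some subset of
  \<open>J\<close> has odd sum in each row of \<open>A\<close>; let \<open>B\<close> be a largest one. The columns of \<open>J - B\<close> are then
  linearly independent on \<open>A\<close>, so \<open>card (J - B) \<le> card A\<close>. In \<open>A \<union> B\<close> all degrees are odd, and
  \<open>card A + card B \<ge> card J = k\<close>.
\<close>

section \<open>Linear systems with independent columns over a field\<close>

text \<open>Induction on \<open>C\<close>: a solution on \<open>J\<close> stays one when a multiple
  of a row combination \<open>b\<close> vanishing on \<open>J\<close> is added. If \<open>b\<close>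
  does not vanish at the new column \<open>j\<close>, a suitable multiple also gives the value
  \<open>f j\<close> there.\<close>

lemma field_indep_columns_solvable:
  fixes M :: "'r \<Rightarrow> 'c \<Rightarrow> 'f :: field"
  assumes "finite R" "finite C"
    and "\<forall>c. (\<forall>i\<in>R. (\<Sum>j\<in>C. c j * M i j) = 0) \<longrightarrow> (\<forall>j\<in>C. c j = 0)"
  shows "\<exists>a. \<forall>j\<in>C. (\<Sum>i\<in>R. a i * M i j) = f j"
  using assms(2,3)
proof (induction C arbitrary: f)
  case (insert j J)
  define v where "v a j = (\<Sum>i\<in>R. a i * M i j)" for a j
  have lin: "v (\<lambda>i. a i + t * b i) l = v a l + t * v b l" for a b t l
    unfolding v_def by (simp add: sum.distrib sum_distrib_left algebra_simps)
  have indep_J: "\<forall>l\<in>J. c l = 0" if c: "\<forall>i\<in>R. (\<Sum>l\<in>J. c l * M i l) = 0" for c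
  proof -
    \<comment> \<open>A relation on \<open>J\<close> extends by coefficient 0 at \<open>j\<close>,
      so independence passes to \<open>J\<close>.\<close>
    have "(\<Sum>l\<in>insert j J. (c(j := 0)) l * M i l) = (\<Sum>l\<in>J. c l * M i l)" for i
      using insert.hyps by (auto intro!: sum.cong)
    then have "\<forall>l\<in>insert j J. (c(j := 0)) l = 0"
      using c by (intro insert.prems[THEN spec, THEN mp]) simp
    then show ?thesis
      using insert.hyps(2) by (metis fun_upd_apply insertCI)
  qed
  have IH: "\<exists>a. \<forall>l\<in>J. v a l = g l" for g
    unfolding v_def using insert.IH indep_J by blast
  obtain a0 where a0: "\<And>l. l \<in> J \<Longrightarrow> v a0 l = f l"
    using IH by blast
  obtain b where b: "\<And>l. l \<in> J \<Longrightarrow> v b l = 0" "v b j \<noteq> 0"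
  proof (rule ccontr)
    \<comment> \<open>If row combinations vanishing on \<open>J\<close> also vanish at \<open>j\<close>, then column \<open>j\<close> is the combination
      of the columns in \<open>J\<close> whose coefficients are the values at \<open>j\<close> of a dual basis \<open>d\<close>.\<close>
    assume "\<not> thesis"
    then have van: "v a j = 0" if "\<And>l. l \<in> J \<Longrightarrow> v a l = 0" for a
      using that \<open>\<And>b. (\<And>l. l \<in> J \<Longrightarrow> v b l = 0) \<Longrightarrow> v b j \<noteq> 0 \<Longrightarrow> thesis\<close> by blast
    have "\<forall>m. \<exists>a. \<forall>l\<in>J. v a l = (if l = m then 1 else 0)"
      by (intro allI IH)
    then obtain d where d: "\<And>m l. l \<in> J \<Longrightarrow> v (d m) l = (if l = m then 1 else 0)"
      by metis
    define c where "c m = (if m = j then 1 else - v (d m) j)" for m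
    have "(\<Sum>m\<in>insert j J. c m * M i m) = 0" if i: "i \<in> R" for i
    proof -
      \<comment> \<open>This combination selects row \<open>i\<close> and subtracts the multiples of
        the dual basis that cancel its values on \<open>J\<close>. By \<open>van\<close> it vanishes
        at \<open>j\<close> too, which is exactly the relation with coefficients \<open>c\<close> in
        row \<open>i\<close>.\<close>
      define a where "a r = (if r = i then 1 else 0) - (\<Sum>m\<in>J. M i m * d m r)" for r
      have va: "v a l = M i l - (\<Sum>m\<in>J. M i m * v (d m) l)" for l
      proof -
        have "v a l = (\<Sum>r\<in>R. (if r = i then M r l else 0) - (\<Sum>m\<in>J. M i m * (d m r * M r l)))"
          unfolding v_def
          by (rule sum.cong) (auto simp: a_def left_diff_distrib sum_distrib_right mult.assoc)
        also have "\<dots> = M i l - (\<Sum>r\<in>R. \<Sum>m\<in>J. M i m * (d m r * M r l))"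
          using i \<open>finite R\<close> by (simp add: sum_subtractf)
        also have "(\<Sum>r\<in>R. \<Sum>m\<in>J. M i m * (d m r * M r l)) = (\<Sum>m\<in>J. M i m * v (d m) l)"
          unfolding v_def by (subst sum.swap) (simp add: sum_distrib_left)
        finally show ?thesis .
      qed
      have "v a l = 0" if l: "l \<in> J" for l
      proof -
        have "(\<Sum>m\<in>J. M i m * v (d m) l) = (\<Sum>m\<in>J. if m = l then M i m else 0)"
          using l by (intro sum.cong) (auto simp: d)
        then show ?thesis
          using l insert.hyps(1) by (simp add: va)
      qed
      then have "M i j - (\<Sum>m\<in>J. M i m * v (d m) j) = 0"
        using van[of a] va[of j] by simp
      moreover have "(\<Sum>m\<in>J. c m * M i m) = - (\<Sum>m\<in>J. M i m * v (d m) j)"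
        unfolding sum_negf[symmetric] using insert.hyps(2)
        by (intro sum.cong) (auto simp: c_def)
      ultimately show ?thesis
        using insert.hyps by (simp add: c_def)
    qed
    then have "c j = 0"
      using insert.prems by blast
    then show False
      by (simp add: c_def)
  qed
  define a where "a i = a0 i + (f j - v a0 j) / v b j * b i" for i
  have "\<forall>l\<in>insert j J. v a l = f l"
    unfolding a_def lin using a0 b by simp
  then show ?case
    unfolding v_def by blast
qed simp

section \<open>Independence over the two-element field in terms of subsets\<close>

text \<open>Over \<open>bit\<close> a coefficient family is the indicator of a subset, so a linear
  relation is a set \<open>D\<close> of columns with zero sum in every row of \<open>R\<close>.
  Columns are indexed, hence two equal columns count as dependent. Swapping the arguments of
  \<open>M\<close> expresses independence of rows.\<close>

definition indep_columns :: "('r \<Rightarrow> 'c \<Rightarrow> bit) \<Rightarrow> 'r set \<Rightarrow> 'c set \<Rightarrow> bool" where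
  "indep_columns M R C \<longleftrightarrow> (\<forall>D\<subseteq>C. (\<forall>i\<in>R. (\<Sum>j\<in>D. M i j) = 0) \<longrightarrow> D = {})"

lemma sum_bit_mult:
  fixes a g :: "'a \<Rightarrow> bit"
  assumes "finite S"
  shows "(\<Sum>i\<in>S. a i * g i) = (\<Sum>i\<in>{i\<in>S. a i = 1}. g i)"
proof -
  have "(\<Sum>i\<in>S. a i * g i) = (\<Sum>i\<in>S. if a i = 1 then g i else 0)"
    by (rule sum.cong) (auto simp: bit_not_one_iff)
  then show ?thesis
    by (simp add: sum.inter_filter[OF assms])
qed

lemma indep_columnsI:
  assumes "finite C"
    and "\<forall>c. (\<forall>i\<in>R. (\<Sum>j\<in>C. c j * M i j) = 0) \<longrightarrow> (\<forall>j\<in>C. c j = 0)"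
  shows "indep_columns M R C"
  unfolding indep_columns_def
proof (intro allI impI)
  fix D assume D: "D \<subseteq> C" "\<forall>i\<in>R. (\<Sum>j\<in>D. M i j) = 0"
  define c :: "'a \<Rightarrow> bit" where "c j = (if j \<in> D then 1 else 0)" for j
  have "{j\<in>C. c j = 1} = D"
    using D(1) by (auto simp: c_def split: if_splits)
  then have "(\<Sum>j\<in>C. c j * M i j) = (\<Sum>j\<in>D. M i j)" for i
    by (metis sum_bit_mult[OF assms(1)])
  then have "\<forall>j\<in>C. c j = 0"
    using D(2) by (intro assms(2)[THEN spec, THEN mp]) simp
  then show "D = {}"
    using D(1) by (auto simp: c_def split: if_splits)
qed

text \<open>\<open>A\<close> is the set of rows with coefficient 1 in a solution over the field
  \<open>bit\<close>.\<close>

lemma indep_columns_row_subset_sum: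
  assumes "finite R" "finite C" and indep: "indep_columns M R C"
  shows "\<exists>A\<subseteq>R. \<forall>j\<in>C. (\<Sum>i\<in>A. M i j) = f j"
proof -
  have "\<forall>c. (\<forall>i\<in>R. (\<Sum>j\<in>C. c j * M i j) = 0) \<longrightarrow> (\<forall>j\<in>C. c j = 0)"
  proof (intro allI impI)
    fix c assume c: "\<forall>i\<in>R. (\<Sum>j\<in>C. c j * M i j) = 0"
    have "{j\<in>C. c j = 1} = {}"
      using indep[unfolded indep_columns_def, THEN spec, THEN mp, OF Collect_restrict] c
      unfolding sum_bit_mult[OF assms(2)] by (rule mp)
    then show "\<forall>j\<in>C. c j = 0"
      using bit_not_one_iff by blast
  qed
  from field_indep_columns_solvable[OF assms(1,2) this, of f]
  obtain a where a: "\<forall>j\<in>C. (\<Sum>i\<in>R. a i * M i j) = f j" ..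
  have "(\<Sum>i\<in>{i\<in>R. a i = 1}. M i j) = f j" if "j \<in> C" for j
    using a[rule_format, OF that] by (subst sum_bit_mult[OF assms(1), symmetric])
  then show ?thesis
    using Collect_restrict[of R "\<lambda>i. a i = 1"] by blast
qed

text \<open>A counting argument replaces dimension theory: every subset of \<open>C\<close> is the
  set of columns where some subset of \<open>R\<close> has sum 1, so \<open>C\<close> has at most as
  many subsets as \<open>R\<close>.\<close>

lemma card_indep_columns_le:
  assumes "finite R" "finite C" "indep_columns M R C"
  shows "card C \<le> card R"
proof -
  have "Pow C \<subseteq> (\<lambda>A. {j\<in>C. (\<Sum>i\<in>A. M i j) = 1}) ` Pow R"
  proof
    fix D assume D: "D \<in> Pow C"
    obtain A where A: "A \<subseteq> R" "\<forall>j\<in>C. (\<Sum>i\<in>A. M i j) = (if j \<in> D then 1 else 0)"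
      using indep_columns_row_subset_sum[OF assms, of "\<lambda>j. if j \<in> D then 1 else 0"] by meson
    have "D = {j\<in>C. (\<Sum>i\<in>A. M i j) = 1}"
      using A(2) D by (auto split: if_splits)
    with A(1) show "D \<in> (\<lambda>A. {j\<in>C. (\<Sum>i\<in>A. M i j) = 1}) ` Pow R"
      by blast
  qed
  then have "card (Pow C) \<le> card (Pow R)"
    using \<open>finite R\<close> by (meson finite_Pow_iff surj_card_le)
  then show ?thesis
    using assms by (simp add: card_Pow)
qed

section \<open>The extremal choice of rows and columns\<close>

text \<open>The sums over \<open>A\<close> equal 1 on all of \<open>C\<close>, not just on
  \<open>B\<close>; this leaves \<open>B\<close> free to grow within \<open>C\<close> without
  spoiling the parity of its columns.\<close>

lemma odd_submatrix_exists:
  fixes M :: "'r \<Rightarrow> 'c \<Rightarrow> bit"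
  assumes "finite R" "finite C" "indep_columns M R C"
  obtains A B where "A \<subseteq> R" "B \<subseteq> C"
    and "\<forall>j\<in>C. (\<Sum>i\<in>A. M i j) = 1"
    and "\<forall>i\<in>A. (\<Sum>j\<in>B. M i j) = 1"
    and "card C \<le> card A + card B"
proof -
  define P where "P A \<longleftrightarrow> A \<subseteq> R \<and> (\<forall>j\<in>C. (\<Sum>i\<in>A. M i j) = 1)" for A
  obtain A0 where "P A0"
    using indep_columns_row_subset_sum[OF assms, of "\<lambda>_. 1"] unfolding P_def by meson
  from ex_has_least_nat[of P, OF this, of card]
  obtain A where "P A" and Amin: "\<And>A'. P A' \<Longrightarrow> card A \<le> card A'"
    by metis
  then have A: "A \<subseteq> R" "\<forall>j\<in>C. (\<Sum>i\<in>A. M i j) = 1"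
    by (auto simp: P_def)
  have finA: "finite A"
    using A(1) assms(1) finite_subset by blast
  have rows: "indep_columns (\<lambda>j i. M i j) C A"
    unfolding indep_columns_def
  proof (intro allI impI)
    fix D assume D: "D \<subseteq> A" "\<forall>j\<in>C. (\<Sum>i\<in>D. M i j) = 0"
    \<comment> \<open>Deleting rows with zero sum on \<open>C\<close> preserves the column sums, so
      minimality of \<open>A\<close> forces \<open>D\<close> to be empty.\<close>
    have "P (A - D)"
      unfolding P_def using A D finA by (auto simp: sum_diff)
    then have "card A \<le> card (A - D)"
      by (rule Amin)
    then have "A - D = A"
      by (rule card_seteq[OF finA Diff_subset])
    then show "D = {}"
      using D(1) by blast
  qed
  define Q where "Q B \<longleftrightarrow> B \<subseteq> C \<and> (\<forall>i\<in>A. (\<Sum>j\<in>B. M i j) = 1)" for B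
  obtain B0 where "Q B0"
    using indep_columns_row_subset_sum[OF assms(2) finA rows, of "\<lambda>_. 1"] unfolding Q_def by meson
  moreover have "\<forall>B. Q B \<longrightarrow> card B \<le> card C"
    unfolding Q_def using assms(2) card_mono by blast
  ultimately have "\<exists>B. Q B \<and> (\<forall>B'. Q B' \<longrightarrow> card B' \<le> card B)"
    using ex_has_greatest_nat[of Q B0 card "Suc (card C)"] by (simp add: less_Suc_eq_le)
  then obtain B where "Q B" and Bmax: "\<And>B'. Q B' \<Longrightarrow> card B' \<le> card B"
    by metis
  then have B: "B \<subseteq> C" "\<forall>i\<in>A. (\<Sum>j\<in>B. M i j) = 1"
    by (auto simp: Q_def)
  have finB: "finite B"
    using B(1) assms(2) finite_subset by blast
  have "indep_columns M A (C - B)"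
    unfolding indep_columns_def
  proof (intro allI impI)
    fix D assume D: "D \<subseteq> C - B" "\<forall>i\<in>A. (\<Sum>j\<in>D. M i j) = 0"
    have finD: "finite D"
      using D(1) assms(2) finite_subset by blast
    have disj: "B \<inter> D = {}"
      using D(1) by blast
    \<comment> \<open>Adding columns with zero sum on \<open>A\<close> preserves the row sums, so
      maximality of \<open>B\<close> forces \<open>D\<close> to be empty.\<close>
    have "Q (B \<union> D)"
      unfolding Q_def using B D by (auto simp: sum.union_disjoint[OF finB finD disj])
    from Bmax[OF this] show "D = {}"
      using card_Un_disjoint[OF finB finD disj] finD by simp
  qed
  then have "card (C - B) \<le> card A"
    using card_indep_columns_le finA assms(2) by blast
  then have "card C \<le> card A + card B"
    using card_Diff_subset[OF finB B(1)] by linarith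
  then show thesis
    using that A B by blast
qed

section \<open>From matrix rank to independent column indices\<close>

text \<open>The library rank is the size of a maximal independent set \<open>U\<close> of column
  vectors, in which repeated columns coincide. Choosing one index for each vector of
  \<open>U\<close> gives \<open>J\<close>.\<close>

lemma rank_indep_columns:
  fixes M :: "'f :: field mat"
  assumes M: "M \<in> carrier_mat n m"
  obtains J where "J \<subseteq> {..<m}" "card J = vec_space.rank n M"
    and "\<forall>c. (\<forall>i<n. (\<Sum>j\<in>J. c j * M $$ (i, j)) = 0) \<longrightarrow> (\<forall>j\<in>J. c j = 0)"
proof -
  interpret vec_space "TYPE('f)" n .
  have "lin_indpt {}"
    unfolding lin_dep_def by blast
  then obtain U where U: "maximal U (\<lambda>T. T \<subseteq> set (cols M) \<and> lin_indpt T)"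
    using maximal_exists_superset[of "set (cols M)" "\<lambda>T. T \<subseteq> set (cols M) \<and> lin_indpt T" "{}"]
    by blast
  then have Ucols: "U \<subseteq> set (cols M)" and indpt: "lin_indpt U"
    unfolding maximal_def by auto
  have "set (cols M) = col M ` {..<m}"
    using M by (auto simp: cols_def)
  then obtain J where J: "J \<subseteq> {..<m}" "inj_on (col M) J" "U = col M ` J"
    using Ucols by (metis subset_image_inj)
  have finU: "finite U"
    using Ucols finite_subset by blast
  have carr: "U \<subseteq> carrier_vec n"
    using M J(3) by auto
  have "\<forall>j\<in>J. c j = 0" if c: "\<forall>i<n. (\<Sum>j\<in>J. c j * M $$ (i, j)) = 0" for c
  proof -
    \<comment> \<open>Coefficients on indices become coefficients on vectors, since
      \<open>col M\<close> is injective on \<open>J\<close>.\<close>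
    define a where "a = (\<lambda>u. c (the_inv_into J (col M) u))"
    have a: "a (col M j) = c j" if "j \<in> J" for j
      using that J(2) by (simp add: a_def the_inv_into_f_f)
    have "lincomb a U = 0\<^sub>v n"
    proof (rule eq_vecI)
      fix i assume i: "i < dim_vec (0\<^sub>v n :: 'f vec)"
      then have "lincomb a U $ i = (\<Sum>u\<in>U. a u * u $ i)"
        using lincomb_index[OF _ carr] by simp
      also have "\<dots> = (\<Sum>j\<in>J. a (col M j) * col M j $ i)"
        unfolding J(3) by (simp add: sum.reindex[OF J(2)])
      also have "\<dots> = (\<Sum>j\<in>J. c j * M $$ (i, j))"
        using i M J(1) by (intro sum.cong) (auto simp: a)
      finally show "lincomb a U $ i = 0\<^sub>v n $ i"
        using i c by simp
    qed (use carr finU in \<open>simp add: lincomb_dim\<close>)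
    then have "a u = 0" if "u \<in> U" for u
      using indpt finU that unfolding lin_dep_def by auto
    then show ?thesis
      using a J(3) by auto
  qed
  moreover have "card J = rank M"
    using rank_card_indpt[OF M U] J(2,3) by (simp add: card_image)
  ultimately show thesis
    using that J(1) by blast
qed

section \<open>Vertex degrees and the graph theorem\<close>

lemma odd_card_iff_sum_bit:
  assumes "finite B"
  shows "odd (card {y\<in>B. P y}) \<longleftrightarrow> (\<Sum>y\<in>B. if P y then 1 else 0) = (1 :: bit)"
proof -
  have "of_nat n = (1 :: bit) \<longleftrightarrow> odd n" for n
    by (induction n) auto
  then show ?thesis
    using assms by (simp add: sum.inter_filter[symmetric])
qed

text \<open>No edge joins two vertices of the same part, so the induced edges at \<open>x\<close>
  correspond to its neighbours in \<open>B\<close>.\<close>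

lemma vdegree_bipartite_induced:
  assumes "bipartite_with_parts V E X Y" "A \<subseteq> X" "B \<subseteq> Y" "x \<in> A"
  shows "vdegree (induced_edges E (A \<union> B)) x = card {y\<in>B. {x, y} \<in> E}"
proof -
  have "{e \<in> induced_edges E (A \<union> B). x \<in> e} = (\<lambda>y. {x, y}) ` {y\<in>B. {x, y} \<in> E}"
    using assms unfolding bipartite_with_parts_def induced_edges_def
    by (fastforce simp: doubleton_eq_iff)
  moreover have "inj_on (\<lambda>y. {x, y}) {y\<in>B. {x, y} \<in> E}"
    by (auto simp: inj_on_def doubleton_eq_iff)
  ultimately show ?thesis
    unfolding vdegree_def by (simp add: card_image)
qed

lemma bipartite_with_parts_commute:
  assumes "bipartite_with_parts V E X Y"
  shows "bipartite_with_parts V E Y X"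
proof -
  have "\<exists>y\<in>Y. \<exists>x\<in>X. e = {y, x}" if "e \<in> E" for e
  proof -
    obtain x y where "x \<in> X" "y \<in> Y" "e = {x, y}"
      using assms \<open>e \<in> E\<close> unfolding bipartite_with_parts_def by blast
    then show ?thesis
      using insert_commute[of x y "{}"] by blast
  qed
  then show ?thesis
    using assms unfolding bipartite_with_parts_def by blast
qed

theorem corollary17:
  fixes V X Y :: "'a set" and E :: "'a set set" and xs ys :: "'a list" and k :: nat
  assumes "simple_graph V E"
    and "bipartite_with_parts V E X Y"
    and "distinct xs" and "set xs = X"
    and "distinct ys" and "set ys = Y"
    and "k = bip_rank E xs ys"
  shows "f_o V E \<ge> k"
proof -
  define M where "M i j = (if {xs ! i, ys ! j} \<in> E then 1 else 0 :: bit)" for i j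
  have "bip_adj_mat E xs ys \<in> carrier_mat (length xs) (length ys)"
    by (simp add: bip_adj_mat_def)
  then obtain J where J: "J \<subseteq> {..<length ys}" "card J = k"
    and indep: "\<forall>c. (\<forall>i<length xs. (\<Sum>j\<in>J. c j * bip_adj_mat E xs ys $$ (i, j)) = 0)
      \<longrightarrow> (\<forall>j\<in>J. c j = 0)"
    unfolding assms(7) bip_rank_def by (rule rank_indep_columns)
  have finJ: "finite J"
    using J(1) finite_subset by blast
  have eq: "(\<Sum>j\<in>J. c j * bip_adj_mat E xs ys $$ (i, j)) = (\<Sum>j\<in>J. c j * M i j)"
    if "i < length xs" for c i
    using that J(1) by (intro sum.cong) (auto simp: bip_adj_mat_def M_def)
  have "indep_columns M {..<length xs} J"
  proof (rule indep_columnsI[OF finJ], intro allI impI)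
    fix c assume c: "\<forall>i\<in>{..<length xs}. (\<Sum>j\<in>J. c j * M i j) = 0"
    have "\<forall>i<length xs. (\<Sum>j\<in>J. c j * bip_adj_mat E xs ys $$ (i, j)) = 0"
      by (intro allI impI) (rule trans[OF eq c[rule_format]], simp_all)
    then show "\<forall>j\<in>J. c j = 0"
      by (rule indep[THEN spec, THEN mp])
  qed
  then obtain I K where I: "I \<subseteq> {..<length xs}" and K: "K \<subseteq> J"
    and colI: "\<forall>j\<in>J. (\<Sum>i\<in>I. M i j) = 1"
    and rowK: "\<forall>i\<in>I. (\<Sum>j\<in>K. M i j) = 1"
    and card: "card J \<le> card I + card K"
    by (rule odd_submatrix_exists[of "{..<length xs}" J M, OF finite_lessThan finJ])
  define A B where "A = (!) xs ` I" and "B = (!) ys ` K"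
  \<comment> \<open>Distinctness of the enumerations lets both sums and cardinalities pass between
    indices and vertices.\<close>
  have injI: "inj_on ((!) xs) I"
    using assms(3) I by (intro inj_on_nth) auto
  have injK: "inj_on ((!) ys) K"
    using assms(5) J(1) K by (intro inj_on_nth) auto
  have fin: "finite A" "finite B"
    using I K finJ finite_subset unfolding A_def B_def by blast+
  have AX: "A \<subseteq> X" and BY: "B \<subseteq> Y"
    using I K J(1) assms(4,6) unfolding A_def B_def by auto
  have odd: "odd (vdegree (induced_edges E (A \<union> B)) v)" if "v \<in> A \<union> B" for v
    using that
  proof
    assume v: "v \<in> A"
    then obtain i where i: "i \<in> I" "v = xs ! i"
      unfolding A_def by blast
    have "(\<Sum>y\<in>B. if {v, y} \<in> E then 1 else 0) = (\<Sum>j\<in>K. M i j)"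
      unfolding B_def M_def i(2) by (simp add: sum.reindex[OF injK])
    then show ?thesis
      using vdegree_bipartite_induced[OF assms(2) AX BY v] rowK[rule_format, OF i(1)]
      by (simp add: odd_card_iff_sum_bit[OF fin(2)])
  next
    assume v: "v \<in> B"
    then obtain j where j: "j \<in> K" "v = ys ! j"
      unfolding B_def by blast
    \<comment> \<open>The same computation with the parts exchanged; \<open>colI\<close> applies
      because \<open>K\<close> lies in \<open>J\<close>.\<close>
    have "(\<Sum>x\<in>A. if {v, x} \<in> E then 1 else 0) = (\<Sum>i\<in>I. M i j)"
      unfolding A_def M_def j(2) by (simp add: sum.reindex[OF injI] insert_commute)
    then show ?thesis
      using vdegree_bipartite_induced[OF bipartite_with_parts_commute[OF assms(2)] BY AX v]
        colI[rule_format, of j] j(1) K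
      by (auto simp: odd_card_iff_sum_bit[OF fin(1)] Un_commute)
  qed
  have V: "finite V" "A \<union> B \<subseteq> V" "A \<inter> B = {}"
    using assms(1,2) AX BY unfolding simple_graph_def bipartite_with_parts_def by auto
  have "k \<le> card (A \<union> B)"
    using card J(2) card_Un_disjoint[OF fin V(3)] card_image[OF injI] card_image[OF injK]
    by (simp add: A_def B_def)
  also have "\<dots> \<le> f_o V E"
    unfolding f_o_def
  proof (rule Max_ge)
    show "finite {card S | S. S \<subseteq> V \<and> (\<forall>v\<in>S. odd (vdegree (induced_edges E S) v))}"
      by (rule finite_subset[of _ "card ` Pow V"]) (use V(1) in auto)
  qed (use V(2) odd in blast)
  finally show ?thesis .
qed

end
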